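(* Let $G$ be an abelian group which is free of 2-torsion, $g_0\in G$, and let $\mathcal P=\bigoplus_{g\in G}\mathcal P_g$ be a Poisson color algebra of degree $g_0$ over a field $\mathbb K$ whose restricted support $\Sigma$ is symmetric. Suppose that $\mathcal P$ is centerless, $\Sigma$-multiplicative, of maximal length, and that $\mathcal P_\beta$ is tight for every $\beta\in\{0,\pm g_0,\pm2g_0,-3g_0\}$. Then $\mathcal P$ is the direct sum of the family of its minimal ideals, each one being a simple Poisson color algebra of degree $g_0$ having all of the elements in its restricted support connected.
   Context: $\mathbb K$ is an arbitrary field, $(G,+)$ an abelian group; all algebras have arbitrary dimension. "Free of 2-torsion" means $2x=0$ implies $x=0$ in $G$. A skew-symmetric bicharacter of $G$ is a map $\epsilon:G\times G\to\mathbb K\setminus\{0\}$ with $\epsilon(a,b)=\epsilon(b,a)^{-1}$ and $\epsilon(a,b+c)=\epsilon(a,b)\epsilon(a,c)$. Poisson color algebra of degree $g_0\in G$ (with respect to $\epsilon$): a $G$-graded $\mathbb K$-vector space $\mathcal P=\bigoplus_{g\in G}\mathcal P_g$ with a bilinear product $\{\cdot,\cdot\}$ satisfying $\{\mathcal P_g,\mathcal P_h\}\subset\mathcal P_{g+h+g_0}$ and, for homogeneous $x,y,z$ of degrees $|x|,|y|,|z|$, $\{x,y\}=-\epsilon(|x|+g_0,|y|+g_0)\{y,x\}$ and $\{x,\{y,z\}\}=\{\{x,y\},z\}+\epsilon(|x|+g_0,|y|+g_0)\{y,\{x,z\}\}$; together with a bilinear associative product (juxtaposition) satisfying $\mathcal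 P_g\mathcal P_h\subset\mathcal P_{g+h}$, $xy=\epsilon(|x|,|y|)yx$ and $\{x,yz\}=\{x,y\}z+\epsilon(|x|+g_0,|y|)y\{x,z\}$ for homogeneous $x,y,z$. Products $\{A,B\}$ and $AB$ of subspaces denote linear spans of products of elements. A subalgebra is a graded linear subspace $\mathcal Q$ with $\{\mathcal Q,\mathcal Q\}+\mathcal Q\mathcal Q\subset\mathcal Q$ (it is itself a Poisson color algebra of degree $g_0$ with the induced grading and products); an ideal is a subalgebra $\mathcal I$ (in particular graded) with $\{\mathcal I,\mathcal P\}+\{\mathcal P,\mathcal I\}+\mathcal I\mathcal P+\mathcal P\mathcal I\subset\mathcal I$. A minimal ideal is a minimal element among the nonzero ideals. A Poisson color algebra $\mathcal P$ is simple if $\{\mathcal P,\mathcal P\}\neq0$, $\mathcal P\mathcal P\neq0$ and its only ideals are $\{0\}$ and $\mathcal P$. The center of $\mathcal P$ is $\{v\in\mathcal P:\{v,\mathcal P\}+\{\mathcal P,v\}+v\mathcal P+\mathcal Pv=0\}$; $\mathcal P$ is centerless if its center is $0$. Restricted support of a Poisson color algebra $\mathcal P$ of degree $g_0$: $\Sigma=\{g\in G:\mathcal P_g\neq0\}\setminus\{0,\pm g_0\}$; $-\Sigma=\{-g:g\in\Sigma\}$, $\pm\Sigma=\Sigma\cup(-\Sigma)$. $\Sigma$ is symmetric if $g\in\Sigma$ implies $-g\in\Sigma$. Connection: for $g,h\in\Sigma$, $g$ is connected to $h$ if there exist $n\ge1$, $g_1,\dots,g_n\in\pm\Sigma\cup\{0,\pm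 g_0\}$ and $k_2,\dots,k_n\in\{0,\pm g_0\}$ such that $g_1=g$; for each $2\le m\le n-1$, $g_1+(g_2+k_2)+\cdots+(g_m+k_m)\in\pm\Sigma$; and $g_1+(g_2+k_2)+\cdots+(g_n+k_n)\in\{h,-h\}$. For a minimal ideal, regarded as a Poisson color algebra, connectedness is with respect to its own restricted support. Tightness: for $\alpha\in\{\pm ng_0:n=0,1,2,3\}$, $\mathcal P_\alpha$ is tight if, with $\Sigma'=\Sigma\setminus\{\pm2g_0,\pm3g_0\}$, $$\mathcal P_\alpha=\sum_{\substack{h,p\in\Sigma'\\ p=-h-g_0+\alpha}}\{\mathcal P_h,\mathcal P_p\}+\sum_{\substack{k,q\in\Sigma'\\ q=-k+\alpha}}\mathcal P_k\mathcal P_q.$$ Maximal length: $\mathcal P_0\neq0$ and $\dim\mathcal P_g=1$ for every $g\in\Sigma$. $\Sigma$-multiplicative: whenever $g\in\Sigma$, $h\in\Sigma\cup\{0,\pm g_0\}$ and $k\in\{0,g_0,-g_0\}$ satisfy $g+h+k\in\Sigma$, then $\mathcal P_g\mathcal P_h\neq0$ if $k=0$, $\{\mathcal P_g,\mathcal P_h\}\neq0$ if $k=g_0$, and $(\mathcal P_g\mathcal P_h)\mathcal P_{-g_0}\neq0$ if $k=-g_0$. *)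

theory Defs
  imports Complex_Main
begin

definition skew_bicharacter :: "('g::ab_group_add \<Rightarrow> 'g \<Rightarrow> 'k::field) \<Rightarrow> bool" where
  "skew_bicharacter eps \<longleftrightarrow>
     (\<forall>a b. eps a b \<noteq> 0) \<and>
     (\<forall>a b. eps a b = inverse (eps b a)) \<and>
     (\<forall>a b c. eps a (b + c) = eps a b * eps a c)"

definition restricted_support :: "'g::ab_group_add \<Rightarrow> ('g \<Rightarrow> 'v::zero set) \<Rightarrow> 'g set" where
  "restricted_support g0 P = {g. P g \<noteq> {0}} - {0, g0, - g0}"

definition symmetric_set :: "'g::ab_group_add set \<Rightarrow> bool" where
  "symmetric_set S \<longleftrightarrow> (\<forall>g\<in>S. - g \<in> S)"

(* gs 1, ..., gs n and ks 2, ..., ks n are the sequences of a connection from g to h in the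
   support S; values at other indices are irrelevant. *)
definition support_connected :: "'g::ab_group_add \<Rightarrow> 'g set \<Rightarrow> 'g \<Rightarrow> 'g \<Rightarrow> bool" where
  "support_connected g0 S g h \<longleftrightarrow>
     (\<exists>n\<ge>1. \<exists>gs ks :: nat \<Rightarrow> 'g.
        (\<forall>i\<in>{1..n}. gs i \<in> S \<union> uminus ` S \<union> {0, g0, - g0}) \<and>
        (\<forall>i\<in>{2..n}. ks i \<in> {0, g0, - g0}) \<and>
        gs 1 = g \<and>
        (\<forall>m\<in>{2..n - 1}. gs 1 + (\<Sum>i=2..m. gs i + ks i) \<in> S \<union> uminus ` S) \<and>
        gs 1 + (\<Sum>i=2..n. gs i + ks i) \<in> {h, - h})"

context vector_space
begin

definition direct_sum :: "'i set \<Rightarrow> ('i \<Rightarrow> 'b set) \<Rightarrow> 'b set \<Rightarrow> bool" where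
  "direct_sum J U V \<longleftrightarrow>
     (\<forall>j\<in>J. subspace (U j)) \<and>
     V = span (\<Union>j\<in>J. U j) \<and>
     (\<forall>F x. finite F \<longrightarrow> F \<subseteq> J \<longrightarrow> (\<forall>j\<in>F. x j \<in> U j) \<longrightarrow> (\<Sum>j\<in>F. x j) = 0
        \<longrightarrow> (\<forall>j\<in>F. x j = 0))"

definition bilinear_on :: "'b set \<Rightarrow> ('b \<Rightarrow> 'b \<Rightarrow> 'b) \<Rightarrow> bool" where
  "bilinear_on V f \<longleftrightarrow>
     (\<forall>x\<in>V. \<forall>y\<in>V. \<forall>z\<in>V.
        f (x + y) z = f x z + f y z \<and> f x (y + z) = f x y + f x z) \<and>
     (\<forall>c. \<forall>x\<in>V. \<forall>y\<in>V.
        f (scale c x) y = scale c (f x y) \<and> f x (scale c y) = scale c (f x y))"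

definition span_prod :: "('b \<Rightarrow> 'b \<Rightarrow> 'b) \<Rightarrow> 'b set \<Rightarrow> 'b set \<Rightarrow> 'b set" where
  "span_prod f A B = span {f a b | a b. a \<in> A \<and> b \<in> B}"

end

(* The algebra is a subspace V of the ambient vector space, with homogeneous components P g;
   the products are only constrained on V. An explicit carrier lets a graded subspace Q be
   regarded as an algebra in its own right, with components Q \<inter> P g. *)
locale poisson_color_algebra = vector_space scale
  for scale :: "'k::field \<Rightarrow> 'v::ab_group_add \<Rightarrow> 'v" +
  fixes eps :: "'g::ab_group_add \<Rightarrow> 'g \<Rightarrow> 'k"
    and g0 :: 'g
    and V :: "'v set"
    and P :: "'g \<Rightarrow> 'v set"
    and br :: "'v \<Rightarrow> 'v \<Rightarrow> 'v"
    and mu :: "'v \<Rightarrow> 'v \<Rightarrow> 'v"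
  assumes bichar: "skew_bicharacter eps"
    and grading: "direct_sum UNIV P V"
    and br_bilinear: "bilinear_on V br"
    and br_degree: "\<And>g h x y. x \<in> P g \<Longrightarrow> y \<in> P h \<Longrightarrow> br x y \<in> P (g + h + g0)"
    and br_skew: "\<And>g h x y. x \<in> P g \<Longrightarrow> y \<in> P h \<Longrightarrow>
      br x y = - scale (eps (g + g0) (h + g0)) (br y x)"
    and br_jacobi: "\<And>g h k x y z. x \<in> P g \<Longrightarrow> y \<in> P h \<Longrightarrow> z \<in> P k \<Longrightarrow>
      br x (br y z) = br (br x y) z + scale (eps (g + g0) (h + g0)) (br y (br x z))"
    and mu_bilinear: "bilinear_on V mu"
    and mu_assoc: "\<And>x y z. x \<in> V \<Longrightarrow> y \<in> V \<Longrightarrow> z \<in> V \<Longrightarrow>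
      mu (mu x y) z = mu x (mu y z)"
    and mu_degree: "\<And>g h x y. x \<in> P g \<Longrightarrow> y \<in> P h \<Longrightarrow> mu x y \<in> P (g + h)"
    and mu_comm: "\<And>g h x y. x \<in> P g \<Longrightarrow> y \<in> P h \<Longrightarrow>
      mu x y = scale (eps g h) (mu y x)"
    and leibniz: "\<And>g h k x y z. x \<in> P g \<Longrightarrow> y \<in> P h \<Longrightarrow> z \<in> P k \<Longrightarrow>
      br x (mu y z) = mu (br x y) z + scale (eps (g + g0) h) (mu y (br x z))"
begin

definition graded_subspace :: "'v set \<Rightarrow> bool" where
  "graded_subspace Q \<longleftrightarrow>
     subspace Q \<and> Q \<subseteq> V \<and> direct_sum UNIV (\<lambda>g. Q \<inter> P g) Q"

definition subalgebra :: "'v set \<Rightarrow> bool" where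
  "subalgebra Q \<longleftrightarrow>
     graded_subspace Q \<and> span_prod br Q Q \<subseteq> Q \<and> span_prod mu Q Q \<subseteq> Q"

definition ideal :: "'v set \<Rightarrow> bool" where
  "ideal I \<longleftrightarrow>
     subalgebra I \<and>
     span_prod br I V \<subseteq> I \<and> span_prod br V I \<subseteq> I \<and>
     span_prod mu I V \<subseteq> I \<and> span_prod mu V I \<subseteq> I"

definition minimal_ideal :: "'v set \<Rightarrow> bool" where
  "minimal_ideal I \<longleftrightarrow>
     ideal I \<and> I \<noteq> {0} \<and> (\<forall>J. ideal J \<longrightarrow> J \<noteq> {0} \<longrightarrow> J \<subseteq> I \<longrightarrow> J = I)"

definition simple_algebra :: bool where
  "simple_algebra \<longleftrightarrow>
     span_prod br V V \<noteq> {0} \<and> span_prod mu V V \<noteq> {0} \<and>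
     (\<forall>I. ideal I \<longrightarrow> I = {0} \<or> I = V)"

definition center :: "'v set" where
  "center = {v \<in> V. \<forall>x\<in>V. br v x = 0 \<and> br x v = 0 \<and> mu v x = 0 \<and> mu x v = 0}"

definition centerless :: bool where
  "centerless \<longleftrightarrow> center = {0}"

definition tight :: "'g \<Rightarrow> bool" where
  "tight \<alpha> \<longleftrightarrow>
     (let S = restricted_support g0 P
                - {g0 + g0, - (g0 + g0), g0 + g0 + g0, - (g0 + g0 + g0)}
      in P \<alpha> = span
           (\<Union> {span_prod br (P h) (P p) | h p. h \<in> S \<and> p \<in> S \<and> p = - h - g0 + \<alpha>} \<union>
            \<Union> {span_prod mu (P k) (P q) | k q. k \<in> S \<and> q \<in> S \<and> q = - k + \<alpha>}))"

definition maximal_length :: bool where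
  "maximal_length \<longleftrightarrow> P 0 \<noteq> {0} \<and> (\<forall>g\<in>restricted_support g0 P. dim (P g) = 1)"

definition support_multiplicative :: bool where
  "support_multiplicative \<longleftrightarrow>
     (\<forall>g \<in> restricted_support g0 P. \<forall>h \<in> restricted_support g0 P \<union> {0, g0, - g0}.
      \<forall>k \<in> {0, g0, - g0}. g + h + k \<in> restricted_support g0 P \<longrightarrow>
        (k = 0 \<longrightarrow> span_prod mu (P g) (P h) \<noteq> {0}) \<and>
        (k = g0 \<longrightarrow> span_prod br (P g) (P h) \<noteq> {0}) \<and>
        (k = - g0 \<longrightarrow> span_prod mu (span_prod mu (P g) (P h)) (P (- g0)) \<noteq> {0}))"

end

end

theory Submission
  imports Defs
begin

text \<open>
  Call two elements orthogonal if all four of their products vanish. By symmetry of the support,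
  connection is an equivalence relation up to sign, and components of unconnected degrees are
  orthogonal. The components of a connection class together with their pairwise products span a
  block. By the Jacobi and Leibniz identities distinct blocks are orthogonal, and by tightness in
  degrees \<open>0\<close> and \<open>\<plusminus>g0\<close> the blocks span \<open>V\<close>. Since the center vanishes, their sum is direct
  and each block is the common annihilator of the others, hence an ideal.

  A nonzero ideal contains a component \<open>P g\<close> with \<open>g\<close> in the support: a homogeneous element of
  degree \<open>0\<close> or \<open>\<plusminus>g0\<close> in an ideal without such a component annihilates all \<open>P h\<close> with \<open>h\<close> in the
  support and \<open>h \<noteq> \<plusminus>2g0, -3g0\<close> for degree reasons, and tightness propagates this to the whole
  algebra. Multiplicativity and one-dimensionality then carry \<open>P g\<close> along connections, so the ideal
  contains the block of \<open>g\<close>. Hence the minimal ideals are exactly the blocks.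
\<close>

section \<open>Bilinear maps and spans\<close>

context vector_space
begin

lemma bilinear_on_add:
  assumes "bilinear_on V f" "x \<in> V" "y \<in> V" "z \<in> V"
  shows "f (x + y) z = f x z + f y z" "f x (y + z) = f x y + f x z"
  using assms by (auto simp: bilinear_on_def)

lemma bilinear_on_scale:
  assumes "bilinear_on V f" "x \<in> V" "y \<in> V"
  shows "f (scale c x) y = scale c (f x y)" "f x (scale c y) = scale c (f x y)"
  using assms by (auto simp: bilinear_on_def)

lemma bilinear_on_zero:
  assumes "bilinear_on V f" "x \<in> V"
  shows "f 0 x = 0" "f x 0 = 0"
  using bilinear_on_scale[OF assms assms(2), of 0] by auto

text \<open>Closure of spans under a product is thereby checked on generators only. Bilinearity
  holds only on \<open>V\<close>, so both span inductions carry membership in \<open>V\<close> along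
  with the claim.\<close>

lemma bilinear_on_span:
  assumes f: "bilinear_on V f" and V: "subspace V" and S: "subspace S"
    and A: "A \<subseteq> V" and B: "B \<subseteq> V"
    and AB: "\<And>a b. a \<in> A \<Longrightarrow> b \<in> B \<Longrightarrow> f a b \<in> S"
    and x: "x \<in> span A" and y: "y \<in> span B"
  shows "f x y \<in> S"
proof -
  have step: "f a y \<in> S \<and> y \<in> V" if a: "a \<in> A" for a
    using y
  proof (induction rule: span_induct_alt)
    case base
    then show ?case
      using bilinear_on_zero[OF f] a A S V by (auto simp: subspace_0)
  next
    case (step c b z)
    have "a \<in> V" "b \<in> V" "z \<in> V" "scale c b \<in> V"
      using a A step B V by (auto intro: subspace_scale)
    then show ?case
      using step AB[OF a] S V
      by (auto simp: bilinear_on_add[OF f] bilinear_on_scale[OF f]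
          intro!: subspace_add subspace_scale)
  qed
  have yV: "y \<in> V"
    using y B V by (meson span_minimal subsetD)
  from x have "f x y \<in> S \<and> x \<in> V"
  proof (induction rule: span_induct_alt)
    case base
    then show ?case
      using bilinear_on_zero[OF f] yV S V by (auto simp: subspace_0)
  next
    case (step c b z)
    have "b \<in> V" "z \<in> V" "scale c b \<in> V"
      using A step V by (auto intro: subspace_scale)
    then show ?case
      using step \<open>\<And>a. a \<in> A \<Longrightarrow> f a y \<in> S \<and> y \<in> V\<close> S V yV
      by (auto simp: bilinear_on_add[OF f] bilinear_on_scale[OF f]
          intro!: subspace_add subspace_scale)
  qed
  then show ?thesis by simp
qed

lemma bilinear_on_subset: "bilinear_on V f \<Longrightarrow> U \<subseteq> V \<Longrightarrow> bilinear_on U f"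
  unfolding bilinear_on_def by (meson subsetD)

lemma span_prod_subset_iff:
  
  assumes "subspace S"
  shows "span_prod f A B \<subseteq> S \<longleftrightarrow> (\<forall>a\<in>A. \<forall>b\<in>B. f a b \<in> S)"
proof
  assume "span_prod f A B \<subseteq> S"
  then show "\<forall>a\<in>A. \<forall>b\<in>B. f a b \<in> S"
    unfolding span_prod_def by (blast intro: span_base)
next
  assume "\<forall>a\<in>A. \<forall>b\<in>B. f a b \<in> S"
  with assms show "span_prod f A B \<subseteq> S"
    unfolding span_prod_def by (intro span_minimal) auto
qed

lemma span_prod_nonzeroE:
  assumes "span_prod f A B \<noteq> {0}"
  obtains a b where "a \<in> A" "b \<in> B" "f a b \<noteq> 0"
proof -
  have "\<not> span_prod f A B \<subseteq> {0}"
    using assms span_zero by (auto simp: span_prod_def)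
  then show thesis
    using that by (auto simp: span_prod_subset_iff)
qed

lemma span_prod_nonzeroI: "a \<in> A \<Longrightarrow> b \<in> B \<Longrightarrow> f a b \<noteq> 0 \<Longrightarrow> span_prod f A B \<noteq> {0}"
  unfolding span_prod_def using span_base[of "f a b" "{f a b |a b. a \<in> A \<and> b \<in> B}"] by auto

text \<open>A nonzero vector of a one-dimensional component generates it. This is how maximal length
  enters: one nonzero element of \<open>P g\<close> in an ideal brings in all of
  \<open>P g\<close>.\<close>

lemma dim_1_subset:
  assumes "dim U = 1" "subspace S" "x \<in> S" "x \<in> U" "x \<noteq> 0"
  shows "U \<subseteq> S"
proof -
  obtain B where B: "B \<subseteq> U" "U \<subseteq> span B" "card B = dim U"
    using basis_exists[of U] by metis
  then obtain b where b: "B = {b}"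
    using assms(1) by (metis card_1_singletonE)
  then obtain c where c: "x = scale c b"
    using assms(4) B by (auto simp: span_singleton)
  then have "b = scale (inverse c) x"
    using assms(5) by auto
  then have "b \<in> S"
    using assms subspace_scale by metis
  then show ?thesis
    using B b span_minimal assms(2) by (metis empty_subsetI insert_subset subset_trans)
qed

end

section \<open>Orthogonality and graded ideals\<close>

context poisson_color_algebra
begin

lemma eps_nonzero [simp]: "eps a b \<noteq> 0"
  using bichar unfolding skew_bicharacter_def by blast

lemma subspace_P: "subspace (P g)"
  using grading by (auto simp: direct_sum_def)

lemma span_P: "V = span (\<Union>g. P g)"
  using grading by (auto simp: direct_sum_def)

lemma subspace_V: "subspace V"
  using span_P by simp

lemma P_subset_V: "P g \<subseteq> V"
  using span_P span_base by (metis UNIV_I UN_I subsetI)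

lemma P_in_V: "x \<in> P g \<Longrightarrow> x \<in> V"
  using P_subset_V by auto

lemma br_in_V: "x \<in> V \<Longrightarrow> y \<in> V \<Longrightarrow> br x y \<in> V"
  using bilinear_on_span[OF br_bilinear subspace_V subspace_V, of "\<Union>g. P g" "\<Union>g. P g"]
    br_degree P_subset_V span_P by blast

lemma mu_in_V: "x \<in> V \<Longrightarrow> y \<in> V \<Longrightarrow> mu x y \<in> V"
  using bilinear_on_span[OF mu_bilinear subspace_V subspace_V, of "\<Union>g. P g" "\<Union>g. P g"]
    mu_degree P_subset_V span_P by blast

section \<open>Homogeneous elements and orthogonality\<close>

definition homogeneous :: "'v set" where
  "homogeneous = (\<Union>g. P g)"

lemma homogeneous_in_V: "x \<in> homogeneous \<Longrightarrow> x \<in> V"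
  using P_subset_V by (auto simp: homogeneous_def)

lemma homogeneous_br: "x \<in> homogeneous \<Longrightarrow> y \<in> homogeneous \<Longrightarrow> br x y \<in> homogeneous"
  using br_degree unfolding homogeneous_def by blast

lemma homogeneous_mu: "x \<in> homogeneous \<Longrightarrow> y \<in> homogeneous \<Longrightarrow> mu x y \<in> homogeneous"
  using mu_degree unfolding homogeneous_def by blast

definition orth :: "'v \<Rightarrow> 'v \<Rightarrow> bool" where
  "orth u v \<longleftrightarrow> br u v = 0 \<and> br v u = 0 \<and> mu u v = 0 \<and> mu v u = 0"

lemma orth_sym: "orth u v \<Longrightarrow> orth v u"
  by (auto simp: orth_def)

lemma orthI:
  assumes "u \<in> homogeneous" "v \<in> homogeneous" "br u v = 0" "mu u v = 0"
  shows "orth u v"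
proof -
  obtain g h where deg: "u \<in> P g" "v \<in> P h"
    using assms by (auto simp: homogeneous_def)
  then show ?thesis
    using assms(3,4) br_skew[OF deg(2,1)] mu_comm[OF deg(2,1)] by (simp add: orth_def)
qed

text \<open>The homogeneous elements orthogonal to a fixed homogeneous \<open>u\<close> are closed
  under both products. Only one order of each product has to be computed, since \<open>orthI\<close>
  recovers the other from skew-symmetry and color commutativity. Nearly every later orthogonality
  claim is derived from this.\<close>

lemma orth_products:
  assumes u: "u \<in> homogeneous" and y: "y \<in> homogeneous" and z: "z \<in> homogeneous"
    and uy: "orth u y" and uz: "orth u z"
  shows "orth u (br y z)" "orth u (mu y z)"
proof -
  obtain a b c where deg: "u \<in> P a" "y \<in> P b" "z \<in> P c"
    using u y z by (auto simp: homogeneous_def)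
  have V: "u \<in> V" "y \<in> V" "z \<in> V"
    using u y z homogeneous_in_V by auto
  note zero = bilinear_on_zero[OF br_bilinear] bilinear_on_zero[OF mu_bilinear]
  have "br u (br y z) = 0"
    using br_jacobi[OF deg] uy uz V by (simp add: orth_def zero)
  moreover have "br u (mu y z) = 0"
    using leibniz[OF deg] uy uz V by (simp add: orth_def zero)
  moreover have "mu u (mu y z) = 0"
    using mu_assoc[of u y z] uy V by (simp add: orth_def zero)
  \<comment> \<open>Leibniz is applied to \<open>br y (mu u z)\<close>: the left side and the first
    term on the right vanish, and the remaining term is the wanted product times a nonzero value of
    \<open>eps\<close>.\<close>
  moreover have "mu u (br y z) = 0"
    using leibniz[OF deg(2,1,3)] uy uz V by (simp add: orth_def zero)
  ultimately show "orth u (br y z)" "orth u (mu y z)"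
    using u y z by (auto intro!: orthI homogeneous_br homogeneous_mu)
qed

lemma orth_span:
  assumes A: "A \<subseteq> V" and B: "B \<subseteq> V" and AB: "\<And>a b. a \<in> A \<Longrightarrow> b \<in> B \<Longrightarrow> orth a b"
    and x: "x \<in> span A" and y: "y \<in> span B"
  shows "orth x y"
proof -
  have "br x y \<in> {0}" "mu x y \<in> {0}"
    using AB by (auto simp: orth_def intro!:
        bilinear_on_span[OF br_bilinear subspace_V subspace_single_0 A B _ x y, simplified]
        bilinear_on_span[OF mu_bilinear subspace_V subspace_single_0 A B _ x y, simplified])
  moreover have "br y x \<in> {0}" "mu y x \<in> {0}"
    using AB by (auto simp: orth_def intro!:
        bilinear_on_span[OF br_bilinear subspace_V subspace_single_0 B A _ y x, simplified]
        bilinear_on_span[OF mu_bilinear subspace_V subspace_single_0 B A _ y x, simplified])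
  ultimately show ?thesis
    by (simp add: orth_def)
qed

lemma in_center: "v \<in> V \<Longrightarrow> (\<And>x. x \<in> V \<Longrightarrow> orth v x) \<Longrightarrow> v \<in> center"
  by (auto simp: center_def orth_def)

section \<open>Graded subspaces and ideals\<close>

lemma graded_span:
  assumes "A \<subseteq> homogeneous"
  shows "graded_subspace (span A)"
proof -
  have "A \<subseteq> (\<Union>g. span A \<inter> P g)"
    using assms span_base by (fastforce simp: homogeneous_def)
  then have "span A = span (\<Union>g. span A \<inter> P g)"
    by (metis Int_lower1 SUP_least antisym span_mono span_span)
  moreover have "span A \<subseteq> V"
    using assms homogeneous_in_V subspace_V by (metis span_minimal subsetD subsetI)
  moreover have "\<forall>F x. finite F \<longrightarrow> F \<subseteq> UNIV \<longrightarrow> (\<forall>g\<in>F. x g \<in> span A \<inter> P g)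
      \<longrightarrow> sum x F = 0 \<longrightarrow> (\<forall>g\<in>F. x g = 0)"
    using grading unfolding direct_sum_def by blast
  ultimately show ?thesis
    unfolding graded_subspace_def direct_sum_def
    by (intro conjI ballI subspace_inter subspace_span subspace_P)
qed

lemma graded_subspace_span: "graded_subspace Q \<Longrightarrow> Q = span (Q \<inter> homogeneous)"
  unfolding graded_subspace_def direct_sum_def homogeneous_def Int_UN_distrib by blast

text \<open>Since a graded subspace lies in \<open>V\<close>, stability under products with
  \<open>V\<close> includes the subalgebra conditions.\<close>

lemma ideal_iff:
  "ideal I \<longleftrightarrow> graded_subspace I \<and>
     (\<forall>x\<in>I. \<forall>y\<in>V. br x y \<in> I \<and> br y x \<in> I \<and> mu x y \<in> I \<and> mu y x \<in> I)"
proof (cases "graded_subspace I")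
  case True
  then have I: "subspace I" and IV: "I \<subseteq> V"
    by (auto simp: graded_subspace_def)
  show ?thesis
    unfolding ideal_def subalgebra_def span_prod_subset_iff[OF I]
    using True subsetD[OF IV] by fast
next
  case False
  then show ?thesis
    by (simp add: ideal_def subalgebra_def)
qed

text \<open>For homogeneous generators one-sided closure suffices, because exchanging the factors
  only multiplies a product by a scalar. Bilinearity then extends closure to the spans.\<close>

lemma ideal_span:
  assumes A: "A \<subseteq> homogeneous" and B: "B \<subseteq> homogeneous" and V: "V = span B"
    and closed: "\<And>a b. a \<in> A \<Longrightarrow> b \<in> B \<Longrightarrow> br a b \<in> span A"
      "\<And>a b. a \<in> A \<Longrightarrow> b \<in> B \<Longrightarrow> mu a b \<in> span A"
  shows "ideal (span A)"
proof -
  have sub: "A \<subseteq> V" "B \<subseteq> V"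
    using A B homogeneous_in_V by auto
  have swap: "br b a \<in> span A \<and> mu b a \<in> span A" if ab: "a \<in> A" "b \<in> B" for a b
  proof -
    obtain g h where "a \<in> P g" "b \<in> P h"
      using A B ab unfolding homogeneous_def by blast
    then show ?thesis
      using closed[OF ab] br_skew[of b h a g] mu_comm[of b h a g]
      by (auto intro: span_neg span_scale)
  qed
  show ?thesis
    unfolding ideal_iff
  proof (intro conjI ballI)
    fix x y
    assume x: "x \<in> span A" and y: "y \<in> V"
    have y: "y \<in> span B"
      using y V by blast
    show "br x y \<in> span A"
      by (rule bilinear_on_span[OF br_bilinear subspace_V subspace_span sub closed(1) x y])
    show "mu x y \<in> span A"
      by (rule bilinear_on_span[OF mu_bilinear subspace_V subspace_span sub closed(2) x y])
    show "br y x \<in> span A"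
      by (rule bilinear_on_span[OF br_bilinear subspace_V subspace_span sub(2,1) _ y x])
        (simp add: swap)
    show "mu y x \<in> span A"
      by (rule bilinear_on_span[OF mu_bilinear subspace_V subspace_span sub(2,1) _ y x])
        (simp add: swap)
  qed (rule graded_span[OF A])
qed

lemma ideal_subspace: "ideal I \<Longrightarrow> subspace I"
  by (auto simp: ideal_iff graded_subspace_def)

lemma ideal_subset_V: "ideal I \<Longrightarrow> I \<subseteq> V"
  by (auto simp: ideal_iff graded_subspace_def)

lemma ideal_poisson_color_algebra:
  assumes "ideal I"
  shows "poisson_color_algebra scale eps g0 I (\<lambda>g. I \<inter> P g) br mu"
proof
  have I: "I \<subseteq> V"
    using assms by (rule ideal_subset_V)
  have closed: "\<And>x y. x \<in> I \<Longrightarrow> y \<in> I \<Longrightarrow> br x y \<in> I \<and> mu x y \<in> I"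
    using assms I by (auto simp: ideal_iff)
  show "skew_bicharacter eps" by (rule bichar)
  show "direct_sum UNIV (\<lambda>g. I \<inter> P g) I"
    using assms by (auto simp: ideal_iff graded_subspace_def)
  show "bilinear_on I br" "bilinear_on I mu"
    using I br_bilinear mu_bilinear by (auto intro: bilinear_on_subset)
  fix x y z
  show "mu (mu x y) z = mu x (mu y z)" if "x \<in> I" "y \<in> I" "z \<in> I"
    using that I mu_assoc by blast
  fix g h
  assume x: "x \<in> I \<inter> P g" and y: "y \<in> I \<inter> P h"
  show "br x y \<in> I \<inter> P (g + h + g0)" "mu x y \<in> I \<inter> P (g + h)"
    using x y closed br_degree mu_degree by auto
  show "br x y = - scale (eps (g + g0) (h + g0)) (br y x)" "mu x y = scale (eps g h) (mu y x)"
    using x y br_skew mu_comm by blast+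
  fix k
  assume z: "z \<in> I \<inter> P k"
  show "br x (br y z) = br (br x y) z + scale (eps (g + g0) (h + g0)) (br y (br x z))"
    using x y z br_jacobi by blast
  show "br x (mu y z) = mu (br x y) z + scale (eps (g + g0) h) (mu y (br x z))"
    using x y z leibniz by blast
qed

end

section \<open>Connection in a symmetric support\<close>

text \<open>
  \<open>reach\<close> chains the single steps of a connection; \<open>connected\<close> additionally identifies \<open>g\<close>
  with \<open>- g\<close>, as the endpoint condition of a connection does.
\<close>

locale symmetric_support_connection =
  fixes g0 :: "'g::ab_group_add" and S :: "'g set"
  assumes symmetric: "symmetric_set S"
    and avoids: "S \<inter> {0, g0, - g0} = {}"
begin

definition shifts :: "'g set" where
  "shifts = {0, g0, - g0}"

text \<open>By symmetry, \<open>S\<close> stands for its union with its negatives. Requiring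
  \<open>g'\<close> in \<open>S\<close> encodes the condition on partial sums of a connection, and
  the three values of \<open>k\<close> match the three clauses of multiplicativity.\<close>

definition step :: "'g \<Rightarrow> 'g \<Rightarrow> bool" where
  "step g g' \<longleftrightarrow> g \<in> S \<and> g' \<in> S \<and> (\<exists>h\<in>S \<union> shifts. \<exists>k\<in>shifts. g' = g + h + k)"

abbreviation reach :: "'g \<Rightarrow> 'g \<Rightarrow> bool" where
  "reach \<equiv> step\<^sup>*\<^sup>*"

definition connected :: "'g \<Rightarrow> 'g \<Rightarrow> bool" where
  "connected g h \<longleftrightarrow> reach g h \<or> reach g (- h)"

definition component :: "'g \<Rightarrow> 'g set" where
  "component g = {h \<in> S. connected g h}"

lemma uminus_mem: "g \<in> S \<Longrightarrow> - g \<in> S"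
  using symmetric by (auto simp: symmetric_set_def)

lemma uminus_mem_iff [simp]: "- g \<in> S \<longleftrightarrow> g \<in> S"
  using uminus_mem[of g] uminus_mem[of "- g"] by auto

lemma not_mem_shifts: "g \<in> S \<Longrightarrow> g \<notin> shifts"
  using avoids by (auto simp: shifts_def)

lemma uminus_shifts [simp]: "- k \<in> shifts \<longleftrightarrow> k \<in> shifts"
  unfolding shifts_def by (auto simp: minus_equation_iff)

lemma zero_shifts [simp]: "0 \<in> shifts" "g0 \<in> shifts" "- g0 \<in> shifts"
  by (auto simp: shifts_def)

lemma stepI:
  assumes "g \<in> S" "g' \<in> S" "h \<in> S \<union> shifts" "k \<in> shifts" "g' = g + h + k"
  shows "step g g'"
  using assms by (auto simp: step_def)

section \<open>Connection as an equivalence relation\<close>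

lemma step_sym: "step g h \<Longrightarrow> step h g"
proof -
  assume "step g h"
  then obtain a k where *: "g \<in> S" "h \<in> S" "a \<in> S \<union> shifts" "k \<in> shifts" "h = g + a + k"
    by (auto simp: step_def)
  then show ?thesis
    by (intro stepI[of h g "- a" "- k"]) auto
qed

lemma step_uminus: "step g h \<Longrightarrow> step (- g) (- h)"
proof -
  assume "step g h"
  then obtain a k where *: "g \<in> S" "h \<in> S" "a \<in> S \<union> shifts" "k \<in> shifts" "h = g + a + k"
    by (auto simp: step_def)
  have "- g \<in> S" "- h \<in> S" "- a \<in> S \<union> shifts" "- k \<in> shifts"
    using *(1-4) by simp_all
  then show ?thesis
    by (rule stepI) (simp add: *(5))
qed

lemma reach_sym: "reach g h \<Longrightarrow> reach h g"
  by (induction rule: rtranclp_induct) (auto intro: step_sym converse_rtranclp_into_rtranclp)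

lemma reach_uminus: "reach g h \<Longrightarrow> reach (- g) (- h)"
  by (induction rule: rtranclp_induct) (auto intro: step_uminus rtranclp.rtrancl_into_rtrancl)

lemma connected_refl [simp]: "connected g g" "connected g (- g)"
  by (auto simp: connected_def)

lemma connected_sym: "connected g h \<Longrightarrow> connected h g"
  unfolding connected_def using reach_sym reach_uminus[of g "- h"] by auto

lemma connected_trans:
  assumes "connected g h" "connected h k"
  shows "connected g k"
proof -
  have "reach h k \<or> reach h (- k)" "reach (- h) k \<or> reach (- h) (- k)"
    using assms(2) reach_uminus[of h k] reach_uminus[of h "- k"] by (auto simp: connected_def)
  then show ?thesis
    using assms(1) rtranclp_trans[of step] unfolding connected_def by blast
qed

lemma step_connected: "step g h \<Longrightarrow> connected g h"
  by (auto simp: connected_def)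

lemma component_eq: "connected g h \<Longrightarrow> component g = component h"
  unfolding component_def using connected_trans connected_sym by blast

text \<open>The sum is the degree of a product of elements of degrees \<open>g\<close> and
  \<open>h\<close>: \<open>k = 0\<close> for \<open>mu\<close> and \<open>k = g0\<close> for
  \<open>br\<close>. If it lies in \<open>S\<close>, both \<open>g\<close> and \<open>h\<close> step
  to it. Otherwise it is one of the shifts, and adding it and then \<open>- k\<close> to
  \<open>- g\<close> gives \<open>h\<close>.\<close>

lemma connected_add:
  assumes g: "g \<in> S" and h: "h \<in> S" and k: "k \<in> shifts" and sum: "g + h + k \<in> S \<union> shifts"
    and k2: "k = 0 \<or> k = g0"
  shows "connected g h"
proof (cases "g + h + k \<in> S")
  case True
  have "step g (g + h + k)" "step h (g + h + k)"
    by (rule stepI[OF g True, of h k], use h k in simp_all)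
      (rule stepI[OF h True, of g k], use g k in \<open>simp_all add: add.commute\<close>)
  then show ?thesis
    using step_connected connected_sym connected_trans by blast
next
  case False
  then have m: "g + h + k \<in> shifts"
    using sum by auto
  have "step (- g) h"
    using g h m k uminus_shifts[of k]
    by (intro stepI[of "- g" h "g + h + k" "- k"]) auto
  then show ?thesis
    using step_connected connected_trans connected_refl(2) by blast
qed

text \<open>Unfolds reachability into the sequences of a connection. All summands and partial sums
  stay in the class of \<open>g\<close>, because connectedness in a minimal ideal refers to the
  support of that ideal. Controlling partial sums up to \<open>n\<close>, and not only up to
  \<open>n - 1\<close>, lets the induction append a further step.\<close>

lemma component_reach_chain:
  assumes g: "g \<in> S" and "reach g h"
  shows "\<exists>n\<ge>1. \<exists>gs ks :: nat \<Rightarrow> 'g.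
        (\<forall>i\<in>{1..n}. gs i \<in> component g \<union> shifts) \<and>
        (\<forall>i\<in>{2..n}. ks i \<in> shifts) \<and> gs 1 = g \<and>
        (\<forall>m\<in>{2..n}. gs 1 + (\<Sum>i=2..m. gs i + ks i) \<in> component g) \<and>
        gs 1 + (\<Sum>i=2..n. gs i + ks i) = h"
  using assms(2)
proof (induction rule: rtranclp_induct)
  case base
  show ?case
    by (rule exI[of _ 1], rule conjI, simp, rule exI[of _ "\<lambda>_. g"], rule exI[of _ "\<lambda>_. 0"])
      (use g in \<open>simp add: component_def\<close>)
next
  case (step c d)
  from step.IH obtain n :: nat and gs ks where n: "n \<ge> 1"
    and gs: "\<forall>i\<in>{1..n}. gs i \<in> component g \<union> shifts"
    and ks: "\<forall>i\<in>{2..n}. ks i \<in> shifts" and g1: "gs 1 = g"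
    and partial: "\<forall>m\<in>{2..n}. gs 1 + (\<Sum>i=2..m. gs i + ks i) \<in> component g"
    and last: "gs 1 + (\<Sum>i=2..n. gs i + ks i) = c"
    by (elim exE conjE) (rule that)
  obtain a k where a: "a \<in> S \<union> shifts" and k: "k \<in> shifts" and cd: "c \<in> S" "d \<in> S" "d = c + a + k"
    using step.hyps(2) by (auto simp: step_def)
  have d: "d \<in> component g"
    using step.hyps cd by (auto simp: component_def connected_def intro: rtranclp.rtrancl_into_rtrancl)
  \<comment> \<open>The roles of \<open>c\<close> and \<open>a\<close> in
    \<open>d = c + a + k\<close> can be exchanged: if \<open>a\<close> is in \<open>S\<close>, then
    it steps to \<open>d\<close> by adding \<open>c\<close> and \<open>k\<close>, hence lies in the
    same class.\<close>
  have a': "a \<in> component g \<union> shifts"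
  proof (cases "a \<in> shifts")
    case False
    then have "a \<in> S" using a by auto
    then have "step a d"
      using cd k by (intro stepI[of a d c k]) (auto simp: add.commute)
    then show ?thesis
      using d \<open>a \<in> S\<close> step_connected connected_trans connected_sym
      unfolding component_def by blast
  qed auto
  define gs' ks' where "gs' = gs(Suc n := a)" and "ks' = ks(Suc n := k)"
  have same: "(\<Sum>i=2..m. gs' i + ks' i) = (\<Sum>i=2..m. gs i + ks i)" if "m \<le> n" for m
    using that by (intro sum.cong) (auto simp: gs'_def ks'_def)
  have g1': "gs' 1 = gs 1"
    using n by (auto simp: gs'_def)
  have last': "gs' 1 + (\<Sum>i=2..Suc n. gs' i + ks' i) = d"
    using n last cd same[of n] g1' by (auto simp: gs'_def ks'_def algebra_simps)
  show ?case
  proof (rule exI[of _ "Suc n"], rule conjI, simp, rule exI[of _ gs'], rule exI[of _ ks'],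
      intro conjI ballI)
    fix m
    assume m: "m \<in> {2..Suc n}"
    show "gs' 1 + (\<Sum>i=2..m. gs' i + ks' i) \<in> component g"
    proof (cases "m = Suc n")
      case True
      then show ?thesis using last' d by simp
    next
      case False
      then have "m \<in> {2..n}" using m by auto
      then show ?thesis using same[of m] g1' partial by simp
    qed
  next
    show "gs' i \<in> component g \<union> shifts" if "i \<in> {1..Suc n}" for i
      using that gs a' by (auto simp: gs'_def le_Suc_eq)
    show "ks' i \<in> shifts" if "i \<in> {2..Suc n}" for i
      using that ks k by (auto simp: ks'_def le_Suc_eq)
    show "gs' 1 = g"
      using g1' g1 by (rule trans)
    show "gs' 1 + (\<Sum>i=2..Suc n. gs' i + ks' i) = d"
      by (rule last')
  qed
qed

lemma component_support_connected:
  assumes "a \<in> component g" "b \<in> component g" "g \<in> S"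
  shows "support_connected g0 (component g) a b"
proof -
  have C: "component g = component a"
    using assms component_eq by (auto simp: component_def)
  \<comment> \<open>The sign left open by \<open>connected\<close> is the one allowed at the end of
    a connection.\<close>
  obtain b' where b': "b' \<in> {b, - b}" "reach a b'"
    using assms C by (auto simp: component_def connected_def)
  from assms C have "a \<in> S"
    by (simp add: component_def)
  from component_reach_chain[OF this b'(2), folded C]
  obtain n :: nat and gs ks where n: "n \<ge> 1" and chain: "\<forall>i\<in>{1..n}. gs i \<in> component g \<union> shifts"
    "\<forall>i\<in>{2..n}. ks i \<in> shifts" "gs 1 = a"
    "\<forall>m\<in>{2..n}. gs 1 + (\<Sum>i=2..m. gs i + ks i) \<in> component g"
    "gs 1 + (\<Sum>i=2..n. gs i + ks i) = b'"
    by (elim exE conjE) (rule that)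
  show ?thesis
    unfolding support_connected_def
  proof (rule exI[of _ n], rule conjI[OF n], rule exI[of _ gs], rule exI[of _ ks], intro conjI)
    show "\<forall>i\<in>{1..n}. gs i \<in> component g \<union> uminus ` component g \<union> {0, g0, - g0}"
      using chain(1) unfolding shifts_def by blast
    show "\<forall>i\<in>{2..n}. ks i \<in> {0, g0, - g0}"
      using chain(2) by (simp only: shifts_def)
    show "\<forall>m\<in>{2..n - 1}. gs 1 + (\<Sum>i=2..m. gs i + ks i) \<in> component g \<union> uminus ` component g"
    proof
      fix m
      assume "m \<in> {2..n - 1}"
      then have "m \<in> {2..n}" by auto
      then show "gs 1 + (\<Sum>i=2..m. gs i + ks i) \<in> component g \<union> uminus ` component g"
        using chain(4) by blast
    qed
    show "gs 1 + (\<Sum>i=2..n. gs i + ks i) \<in> {b, - b}"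
      using chain(5) b' by blast
  qed (rule chain(3))
qed

end

section \<open>Blocks\<close>

context poisson_color_algebra
begin

lemma subspace_orth: "u \<in> V \<Longrightarrow> subspace {x \<in> V. orth u x}"
  using subspace_V
  by (intro subspaceI)
    (auto simp: orth_def subspace_0 subspace_add subspace_scale
      bilinear_on_zero[OF br_bilinear] bilinear_on_zero[OF mu_bilinear]
      bilinear_on_add[OF br_bilinear] bilinear_on_add[OF mu_bilinear]
      bilinear_on_scale[OF br_bilinear] bilinear_on_scale[OF mu_bilinear])

lemma unsupported:
  assumes "g \<notin> restricted_support g0 P" "g \<notin> {0, g0, - g0}" "x \<in> P g"
  shows "x = 0"
  using assms by (auto simp: restricted_support_def)

text \<open>Tightness in the form used later: a subspace contains a tight component once it contains
  the generating products.\<close>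

lemma tight_subset:
  assumes "tight \<alpha>" and W: "subspace W"
    and br: "\<And>h p x y. h \<in> restricted_support g0 P \<Longrightarrow> p \<in> restricted_support g0 P \<Longrightarrow>
      h \<notin> {g0 + g0, - (g0 + g0), - (g0 + g0 + g0)} \<Longrightarrow>
      p \<notin> {g0 + g0, - (g0 + g0), - (g0 + g0 + g0)} \<Longrightarrow>
      p = - h - g0 + \<alpha> \<Longrightarrow> x \<in> P h \<Longrightarrow> y \<in> P p \<Longrightarrow> br x y \<in> W"
    and mu: "\<And>h p x y. h \<in> restricted_support g0 P \<Longrightarrow> p \<in> restricted_support g0 P \<Longrightarrow>
      h \<notin> {g0 + g0, - (g0 + g0), - (g0 + g0 + g0)} \<Longrightarrow>
      p \<notin> {g0 + g0, - (g0 + g0), - (g0 + g0 + g0)} \<Longrightarrow>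
      p = - h + \<alpha> \<Longrightarrow> x \<in> P h \<Longrightarrow> y \<in> P p \<Longrightarrow> mu x y \<in> W"
  shows "P \<alpha> \<subseteq> W"
proof -
  let ?S = "restricted_support g0 P
    - {g0 + g0, - (g0 + g0), g0 + g0 + g0, - (g0 + g0 + g0)}"
  have "P \<alpha> = span
           (\<Union> {span_prod br (P h) (P p) | h p. h \<in> ?S \<and> p \<in> ?S \<and> p = - h - g0 + \<alpha>} \<union>
            \<Union> {span_prod mu (P k) (P q) | k q. k \<in> ?S \<and> q \<in> ?S \<and> q = - k + \<alpha>})"
    using assms(1) unfolding tight_def Let_def .
  also have "\<dots> \<subseteq> W"
  proof (intro span_minimal W Un_least Union_least)
    fix X
    assume "X \<in> {span_prod br (P h) (P p) | h p. h \<in> ?S \<and> p \<in> ?S \<and> p = - h - g0 + \<alpha>}"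
    then obtain h p where X: "X = span_prod br (P h) (P p)"
      and hp: "h \<in> ?S" "p \<in> ?S" "p = - h - g0 + \<alpha>"
      by blast
    show "X \<subseteq> W"
      unfolding X span_prod_subset_iff[OF W]
    proof (intro ballI)
      fix x y
      assume "x \<in> P h" "y \<in> P p"
      then show "br x y \<in> W"
        by (rule br[of h p, rotated 5]) (use hp in blast)+
    qed
  next
    fix X
    assume "X \<in> {span_prod mu (P k) (P q) | k q. k \<in> ?S \<and> q \<in> ?S \<and> q = - k + \<alpha>}"
    then obtain h p where X: "X = span_prod mu (P h) (P p)"
      and hp: "h \<in> ?S" "p \<in> ?S" "p = - h + \<alpha>"
      by blast
    show "X \<subseteq> W"
      unfolding X span_prod_subset_iff[OF W]
    proof (intro ballI)
      fix x y
      assume "x \<in> P h" "y \<in> P p"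
      then show "mu x y \<in> W"
        by (rule mu[of h p, rotated 5]) (use hp in blast)+
    qed
  qed
  finally show ?thesis .
qed

end

locale tight_poisson_color_algebra = poisson_color_algebra scale eps g0 V P br mu
  for scale :: "'k::field \<Rightarrow> 'v::ab_group_add \<Rightarrow> 'v"
    and eps :: "'g::ab_group_add \<Rightarrow> 'g \<Rightarrow> 'k" and g0 V P br mu +
  assumes support_symmetric: "symmetric_set (restricted_support g0 P)"
    and centerless: centerless
    and multiplicative: support_multiplicative
    and maximal_length: maximal_length
    and tight: "\<beta> \<in> {0, g0, - g0, g0 + g0, - (g0 + g0), - (g0 + g0 + g0)} \<Longrightarrow> tight \<beta>"
begin

abbreviation S :: "'g set" where
  "S \<equiv> restricted_support g0 P"

sublocale symmetric_support_connection g0 S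
  by standard (rule support_symmetric, auto simp: restricted_support_def)

definition hom_part :: "'g set \<Rightarrow> 'v set" where
  "hom_part C = (\<Union>g\<in>C. P g)"

text \<open>The products account for the share of a class in degrees 0 and \<open>g0\<close>,
  \<open>- g0\<close>, where tightness makes the components sums of products. Generators are kept
  homogeneous so that the color identities apply to them.\<close>

definition gens :: "'g set \<Rightarrow> 'v set" where
  "gens C = hom_part C \<union> {br x y | x y. x \<in> hom_part C \<and> y \<in> hom_part C}
     \<union> {mu x y | x y. x \<in> hom_part C \<and> y \<in> hom_part C}"

definition block :: "'g set \<Rightarrow> 'v set" where
  "block C = span (gens C)"

definition classes :: "'g set set" where
  "classes = component ` S"

section \<open>Orthogonality of distinct classes\<close>

lemma orth_center:
  assumes "v \<in> V" "\<And>x. x \<in> V \<Longrightarrow> orth v x"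
  shows "v = 0"
  using in_center[OF assms] centerless by (simp add: centerless_def)

lemma not_shifts_unsupported: "g \<notin> S \<Longrightarrow> g \<notin> shifts \<Longrightarrow> x \<in> P g \<Longrightarrow> x = 0"
  using unsupported unfolding shifts_def by blast

text \<open>By \<open>connected_add\<close>, the degrees of both products lie outside
  \<open>S\<close> and outside the shifts, so the products are in zero components.\<close>

lemma orth_unconnected:
  assumes g: "g \<in> S" and h: "h \<in> S" and gh: "\<not> connected g h" and x: "x \<in> P g" and y: "y \<in> P h"
  shows "orth x y"
proof (rule orthI)
  show "x \<in> homogeneous" "y \<in> homogeneous"
    using x y by (auto simp: homogeneous_def)
  have "g + h + g0 \<notin> S \<union> shifts" "g + h + 0 \<notin> S \<union> shifts"
    using connected_add[OF g h] gh zero_shifts by blast+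
  then show "br x y = 0" "mu x y = 0"
    using br_degree[OF x y] mu_degree[OF x y] not_shifts_unsupported by auto
qed

lemma class_component: "C \<in> classes \<Longrightarrow> g \<in> C \<Longrightarrow> g \<in> S \<and> C = component g"
  using component_eq by (auto simp: classes_def component_def)

lemma component_mem [simp]: "g \<in> S \<Longrightarrow> g \<in> component g"
  by (simp add: component_def)

lemma component_classes: "g \<in> S \<Longrightarrow> component g \<in> classes"
  by (simp add: classes_def)

lemma hom_part_homogeneous: "hom_part C \<subseteq> homogeneous"
  by (auto simp: hom_part_def homogeneous_def)

lemma gens_homogeneous: "gens C \<subseteq> homogeneous"
  using hom_part_homogeneous homogeneous_br homogeneous_mu unfolding gens_def by blast

lemma gens_subset_V: "gens C \<subseteq> V"
  using gens_homogeneous homogeneous_in_V by blast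

lemma gens_orth:
  assumes C: "C \<in> classes" and D: "D \<in> classes" and CD: "C \<noteq> D"
    and x: "x \<in> gens C" and y: "y \<in> gens D"
  shows "orth x y"
proof -
  have hom: "orth u v" if "u \<in> hom_part C" "v \<in> hom_part D" for u v
  proof -
    obtain g h where gh: "g \<in> C" "h \<in> D" "u \<in> P g" "v \<in> P h"
      using \<open>u \<in> hom_part C\<close> \<open>v \<in> hom_part D\<close> unfolding hom_part_def by blast
    then have "\<not> connected g h"
      using C D CD class_component component_eq by metis
    then show ?thesis
      using gh C D class_component orth_unconnected by metis
  qed
  \<comment> \<open>\<open>orth_products\<close> handles one side at a time: first the generators of
    \<open>D\<close> against a fixed component element, then those of \<open>C\<close> against the
    fixed \<open>y\<close>.\<close>
  have one: "orth u y" if "u \<in> hom_part C" for u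
    using y hom[OF that] that hom_part_homogeneous[of C] hom_part_homogeneous[of D]
    unfolding gens_def by (auto intro!: orth_products)
  have "y \<in> homogeneous"
    using y gens_homogeneous by blast
  then have "orth y x"
    using x orth_sym[OF one] hom_part_homogeneous[of C]
    unfolding gens_def by (auto intro!: orth_products)
  then show ?thesis by (rule orth_sym)
qed

lemma block_orth:
  assumes "C \<in> classes" "D \<in> classes" "C \<noteq> D" "x \<in> block C" "y \<in> block D"
  shows "orth x y"
  using assms(4,5) unfolding block_def
  by (intro orth_span[OF gens_subset_V gens_subset_V gens_orth[OF assms(1-3)]])

lemma P_subset_gens: "g \<in> C \<Longrightarrow> P g \<subseteq> gens C"
  by (auto simp: gens_def hom_part_def)

lemma gens_subset_block: "gens C \<subseteq> block C"
  unfolding block_def by (rule span_superset)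

lemma P_subset_block: "g \<in> C \<Longrightarrow> P g \<subseteq> block C"
  using P_subset_gens gens_subset_block by blast

section \<open>Decomposition into blocks\<close>

lemma zero_in_P: "0 \<in> P g"
  by (rule subspace_0[OF subspace_P])

lemma zero_in_block: "0 \<in> block C"
  unfolding block_def by (rule span_zero)

text \<open>A component with degree in \<open>S\<close> belongs to its class. In degrees 0 and
  \<open>g0\<close>, \<open>- g0\<close> tightness gives products of two components; each is a
  generator if their degrees are connected and zero if not.\<close>

lemma V_span_gens: "V = span (\<Union>C\<in>classes. gens C)" (is "V = ?W")
proof
  show "?W \<subseteq> V"
    using gens_subset_V by (intro span_minimal subspace_V) blast
  have *: "br x y \<in> ?W" "mu x y \<in> ?W"
    if hp: "h \<in> S" "p \<in> S" and xy: "x \<in> P h" "y \<in> P p" for h p x y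
  proof -
    have "br x y \<in> ?W \<and> mu x y \<in> ?W"
    proof (cases "connected h p")
      case True
      then have "x \<in> hom_part (component h)" "y \<in> hom_part (component h)"
        using hp xy by (auto simp: hom_part_def component_def)
      then have "br x y \<in> gens (component h)" "mu x y \<in> gens (component h)"
        by (auto simp: gens_def)
      then show ?thesis
        using component_classes[OF hp(1)] span_base by blast
    next
      case False
      then show ?thesis
        using orth_unconnected[OF hp False xy] by (simp add: orth_def span_zero)
    qed
    then show "br x y \<in> ?W" "mu x y \<in> ?W" by auto
  qed
  have "P g \<subseteq> ?W" for g
  proof (cases "g \<in> S")
    case True
    then show ?thesis
      using P_subset_gens[OF component_mem[OF True]] component_classes[OF True]
      by (blast intro: span_base)
  next
    case False
    show ?thesis
    proof (cases "g \<in> shifts")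
      case True
      then have "tight g"
        using tight by (auto simp: shifts_def)
      then show ?thesis
        by (rule tight_subset[OF _ subspace_span]) (rule *; assumption)+
    next
      case False
      then show ?thesis
        using not_shifts_unsupported[OF \<open>g \<notin> S\<close> False] span_zero by blast
    qed
  qed
  then show "V \<subseteq> ?W"
    unfolding span_P by (intro span_minimal) auto
qed

text \<open>Here \<open>b\<close> collects the contributions of all other classes, which are
  orthogonal to the block of \<open>C\<close>.\<close>

lemma block_decomp:
  assumes "C \<in> classes" "v \<in> V"
  obtains a b where "v = a + b" "a \<in> block C" "b \<in> V"
    "\<And>x. x \<in> block C \<Longrightarrow> orth b x"
proof -
  let ?B = "\<Union>D\<in>classes - {C}. gens D"
  have "(\<Union>D\<in>classes. gens D) = gens C \<union> ?B"
    using assms(1) by auto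
  then have "v \<in> span (gens C \<union> ?B)"
    using assms(2) V_span_gens by simp
  then obtain a b where ab: "v = a + b" "a \<in> block C" "b \<in> span ?B"
    unfolding span_Un block_def by blast
  have BV: "?B \<subseteq> V"
    using gens_subset_V by blast
  then have "b \<in> V"
    using ab(3) span_minimal[OF _ subspace_V] by blast
  moreover have "orth b x" if "x \<in> block C" for x
    using that assms(1) gens_orth ab(3)
    by (intro orth_span[OF BV gens_subset_V[of C] _ ab(3)]) (auto simp: block_def)
  ultimately show ?thesis
    using that ab by blast
qed

text \<open>A block contains everything orthogonal to the other blocks. In \<open>v = a + b\<close>
  from \<open>block_decomp\<close>, the part \<open>b\<close> is orthogonal to the block of
  \<open>C\<close> by construction and to the others because \<open>v\<close> and \<open>a\<close>
  are. So \<open>b\<close> is central and vanishes.\<close>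

lemma in_blockI:
  assumes C: "C \<in> classes" and v: "v \<in> V"
    and orth: "\<And>D y. D \<in> classes \<Longrightarrow> D \<noteq> C \<Longrightarrow> y \<in> gens D \<Longrightarrow> orth v y"
  shows "v \<in> block C"
proof -
  obtain a b where ab: "v = a + b" "a \<in> block C" "b \<in> V" "\<And>x. x \<in> block C \<Longrightarrow> orth b x"
    using block_decomp[OF C v] by metis
  have aV: "a \<in> V"
    using ab(2) gens_subset_V span_minimal[OF _ subspace_V] unfolding block_def by blast
  have gen: "orth b y" if D: "D \<in> classes" and y: "y \<in> gens D" for D y
  proof (cases "D = C")
    case True
    then show ?thesis
      using ab(4) y by (simp add: block_def span_base)
  next
    case False
    have "orth y a"
      using block_orth[OF C D] False ab(2) y span_base[OF y] orth_sym by (metis block_def)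
    moreover have "orth y v"
      using orth[OF D False y] by (rule orth_sym)
    moreover have yV: "y \<in> V"
      using y gens_subset_V by blast
    moreover have "b = v - a"
      using ab(1) by simp
    ultimately have "orth y b"
      using subspace_diff[OF subspace_orth[OF yV], of v a] v aV by simp
    then show ?thesis by (rule orth_sym)
  qed
  have "b = 0"
  proof (rule orth_center[OF ab(3)])
    fix x
    assume "x \<in> V"
    then have "x \<in> span (\<Union>D\<in>classes. gens D)"
      using V_span_gens by simp
    moreover have "span (\<Union>D\<in>classes. gens D) \<subseteq> {x \<in> V. orth b x}"
      using gen gens_subset_V by (intro span_minimal subspace_orth ab(3)) blast
    ultimately show "orth b x" by blast
  qed
  then show ?thesis
    using ab by simp
qed

text \<open>Products of generators of distinct blocks vanish. A product of two generators of one
  block is orthogonal to all other blocks by \<open>orth_products\<close>, so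
  \<open>in_blockI\<close> places it back in the block without expanding products of
  products.\<close>

lemma block_ideal:
  assumes C: "C \<in> classes"
  shows "ideal (block C)"
proof -
  have closed: "br a b \<in> span (gens C) \<and> mu a b \<in> span (gens C)"
    if a: "a \<in> gens C" and b: "b \<in> (\<Union>D\<in>classes. gens D)" for a b
  proof -
    obtain D where D: "D \<in> classes" "b \<in> gens D"
      using b by blast
    show ?thesis
    proof (cases "D = C")
      case False
      then show ?thesis
        using gens_orth[OF C D(1) _ a D(2)] by (simp add: orth_def span_zero)
    next
      case True
      have hom: "a \<in> homogeneous" "b \<in> homogeneous"
        using a D gens_homogeneous by auto
      have "orth y (br a b) \<and> orth y (mu a b)" if "E \<in> classes" "E \<noteq> C" "y \<in> gens E" for E y
        using that a D True hom gens_orth[OF that(1) C that(2,3)] gens_homogeneous[of E]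
        by (auto intro!: orth_products)
      then have "br a b \<in> block C" "mu a b \<in> block C"
        using hom br_in_V[of a b] mu_in_V[of a b] homogeneous_in_V orth_sym
        by (blast intro: in_blockI[OF C])+
      then show ?thesis
        by (simp add: block_def)
    qed
  qed
  show ?thesis
    unfolding block_def
    using gens_homogeneous closed by (intro ideal_span[OF _ _ V_span_gens]) blast+
qed

lemma block_nonzero:
  assumes "C \<in> classes"
  shows "block C \<noteq> {0}"
proof -
  obtain g where "g \<in> S" "C = component g"
    using assms by (auto simp: classes_def)
  then have "P g \<subseteq> block C" "P g \<noteq> {0}"
    using P_subset_block[of g C] by (simp, simp add: restricted_support_def)
  then show ?thesis
    using zero_in_P by blast
qed

text \<open>An element of the block whose degree is in \<open>S\<close> but outside \<open>C\<close>
  is orthogonal to its own class as an element of the block, and orthogonal to the block as an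
  element of another class. It is therefore central.\<close>

lemma block_support:
  assumes C: "C \<in> classes"
  shows "restricted_support g0 (\<lambda>g. block C \<inter> P g) = C"
proof -
  have disjoint: "P g \<inter> block C = {0}" if g: "g \<in> S" "g \<notin> C" for g
  proof -
    have D: "component g \<in> classes" "component g \<noteq> C"
      using g component_classes[OF g(1)] component_mem by auto
    have "x = 0" if x: "x \<in> P g" "x \<in> block C" for x
    proof (rule orth_center)
      show xV: "x \<in> V"
        using x P_in_V by blast
      have "orth x y" if E: "E \<in> classes" "y \<in> gens E" for E y
      proof (cases "E = C")
        case False
        then show ?thesis
          using block_orth[OF C E(1)] x E(2) gens_subset_block by blast
      next
        case True
        have "x \<in> gens (component g)"
          using x P_subset_gens[of g "component g"] g by auto
        then show ?thesis
          using gens_orth[OF D(1) E(1)] D(2) True E(2) by blast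
      qed
      then have "span (\<Union>D\<in>classes. gens D) \<subseteq> {y \<in> V. orth x y}"
        using gens_subset_V by (intro span_minimal subspace_orth xV) blast
      then show "orth x y" if "y \<in> V" for y
        using that V_span_gens by blast
    qed
    then show ?thesis
      using zero_in_P zero_in_block by blast
  qed
  have sub: "C \<subseteq> S"
    using C class_component by blast
  show ?thesis
  proof (intro set_eqI iffI)
    fix g
    assume g: "g \<in> restricted_support g0 (\<lambda>g. block C \<inter> P g)"
    then have "block C \<inter> P g \<noteq> {0}" "g \<notin> {0, g0, - g0}"
      by (simp_all add: restricted_support_def)
    moreover from this have "g \<in> S"
      using zero_in_block unfolding restricted_support_def by auto
    ultimately show "g \<in> C"
      using disjoint by (metis Int_commute)
  next
    fix g
    assume g: "g \<in> C"
    then have "block C \<inter> P g = P g" "g \<in> S"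
      using P_subset_block sub by auto
    then show "g \<in> restricted_support g0 (\<lambda>g. block C \<inter> P g)"
      by (simp add: restricted_support_def)
  qed
qed

end

section \<open>Minimal ideals\<close>

context tight_poisson_color_algebra
begin

section \<open>Components contained in an ideal\<close>

lemma ideal_closed:
  assumes "ideal I" "x \<in> I" "y \<in> V"
  shows "br x y \<in> I" "br y x \<in> I" "mu x y \<in> I" "mu y x \<in> I"
  using assms by (auto simp: ideal_iff)

lemma P_subset_ideal:
  assumes "ideal I" "g \<in> S" "x \<in> I" "x \<in> P g" "x \<noteq> 0"
  shows "P g \<subseteq> I"
  using assms maximal_length ideal_subspace
  by (intro dim_1_subset[of "P g" I x]) (auto simp: maximal_length_def)

text \<open>If a product degree were a shift \<beta>, then \<open>h\<close> would be \<beta> -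
  \<alpha> or \<beta> - \<alpha> - \<open>g0\<close>. With \<alpha> and \<beta> among 0 and
  \<open>g0\<close>, \<open>- g0\<close>, these differences are shifts or one of the listed
  multiples; the extra \<open>- g0\<close> accounts for the asymmetric
  \<open>- 3 g0\<close>.\<close>

lemma product_degree_shift:
  assumes "\<alpha> \<in> shifts" "h \<in> S"
    and "h \<notin> {g0 + g0, - (g0 + g0), - (g0 + g0 + g0)}"
  shows "\<alpha> + h \<notin> shifts" "\<alpha> + h + g0 \<notin> shifts"
proof -
  have h: "h \<notin> {0, g0, - g0}"
    using not_mem_shifts[OF assms(2)] by (simp add: shifts_def)
  show "\<alpha> + h \<notin> shifts"
  proof
    assume "\<alpha> + h \<in> shifts"
    then obtain \<beta> where \<beta>: "\<beta> \<in> {0, g0, - g0}" "h = \<beta> - \<alpha>"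
      by (metis add_diff_cancel_left' shifts_def)
    then show False
      using assms h by (auto simp: shifts_def)
  qed
  show "\<alpha> + h + g0 \<notin> shifts"
  proof
    assume "\<alpha> + h + g0 \<in> shifts"
    then obtain \<beta> where \<beta>: "\<beta> \<in> {0, g0, - g0}" "h = \<beta> - \<alpha> - g0"
      by (metis (no_types, lifting) add.assoc add.commute add_diff_cancel_left' diff_diff_eq shifts_def)
    then show False
      using assms h by (auto simp: shifts_def)
  qed
qed

lemma ideal_contains_component:
  assumes I: "ideal I" and nz: "I \<noteq> {0}"
  shows "\<exists>g\<in>S. P g \<subseteq> I"
proof (rule ccontr)
  assume contra: "\<not> ?thesis"
  then have no: "x = 0" if "g \<in> S" "x \<in> I" "x \<in> P g" for g x
    using P_subset_ideal[OF I] that by blast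
  have "\<exists>u\<in>I \<inter> homogeneous. u \<noteq> 0"
  proof (rule ccontr)
    assume "\<not> ?thesis"
    then have "span (I \<inter> homogeneous) \<subseteq> {0}"
      by (intro span_minimal) auto
    moreover have "I = span (I \<inter> homogeneous)"
      using I by (intro graded_subspace_span) (simp add: ideal_iff)
    ultimately have "I \<subseteq> {0}"
      by simp
    then show False
      using nz subspace_0[OF ideal_subspace[OF I]] by blast
  qed
  then obtain u \<alpha> where u: "u \<in> I" "u \<in> P \<alpha>" "u \<noteq> 0"
    by (auto simp: homogeneous_def)
  have uV: "u \<in> V"
    using u P_in_V by blast
  have hom: "u \<in> homogeneous" "\<And>h x. x \<in> P h \<Longrightarrow> x \<in> homogeneous"
    using u by (auto simp: homogeneous_def)
  have \<alpha>: "\<alpha> \<in> shifts"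
    using no not_shifts_unsupported u by blast
  \<comment> \<open>Under the assumption for contradiction, \<open>I\<close> has homogeneous
    elements only in the shift degrees, so a product with \<open>u\<close> of any other degree must
    vanish.\<close>
  have vanish: "x = 0" if "\<beta> \<notin> shifts" "x \<in> I" "x \<in> P \<beta>" for \<beta> x
    using no not_shifts_unsupported that by blast
  have generic: "orth u x"
    if h: "h \<in> S" "h \<notin> {g0 + g0, - (g0 + g0), - (g0 + g0 + g0)}" and x: "x \<in> P h" for h x
  proof (rule orthI)
    show "u \<in> homogeneous" "x \<in> homogeneous"
      using hom x by auto
    show "br u x = 0"
      using vanish[OF product_degree_shift(2)[OF \<alpha> h]] ideal_closed(1)[OF I u(1) P_in_V[OF x]]
        br_degree[OF u(2) x] by blast
    show "mu u x = 0"
      using vanish[OF product_degree_shift(1)[OF \<alpha> h]] ideal_closed(3)[OF I u(1) P_in_V[OF x]]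
        mu_degree[OF u(2) x] by blast
  qed
  have tight_orth: "P \<beta> \<subseteq> {x \<in> V. orth u x}" if "tight \<beta>" for \<beta>
  proof (rule tight_subset[OF that subspace_orth[OF uV]])
    fix h p x y
    assume "h \<in> S" "p \<in> S" "h \<notin> {g0 + g0, - (g0 + g0), - (g0 + g0 + g0)}"
      "p \<notin> {g0 + g0, - (g0 + g0), - (g0 + g0 + g0)}" and xy: "x \<in> P h" "y \<in> P p"
    then have "orth u x" "orth u y"
      using generic by blast+
    then have "orth u (br x y)" "orth u (mu x y)"
      using orth_products hom xy by blast+
    then show "br x y \<in> {x \<in> V. orth u x}" "mu x y \<in> {x \<in> V. orth u x}"
      using br_in_V mu_in_V P_in_V xy by auto
  qed
  have "P h \<subseteq> {x \<in> V. orth u x}" for h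
  \<comment> \<open>The degrees not reached by \<open>generic\<close> are those where tightness is
    assumed, apart from degrees with zero component. Hence \<open>u\<close> is central.\<close>
  proof (cases "h \<in> shifts \<union> {g0 + g0, - (g0 + g0), - (g0 + g0 + g0)}")
    case True
    then show ?thesis
      by (intro tight_orth tight) (auto simp: shifts_def)
  next
    case False
    have "orth u x" if x: "x \<in> P h" for x
    proof (cases "h \<in> S")
      case True
      then show ?thesis
        using generic[OF True _ x] False by blast
    next
      case notS: False
      then have "x = 0"
        using not_shifts_unsupported[OF notS _ x] False by blast
      then show ?thesis
        using subspace_0[OF subspace_orth[OF uV]] by simp
    qed
    then show ?thesis
      using P_in_V by blast
  qed
  then have "V \<subseteq> {x \<in> V. orth u x}"
    by (subst span_P) (intro span_minimal subspace_orth[OF uV], blast)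
  then show False
    using orth_center[OF uV] u(3) by blast
qed

text \<open>Multiplicativity provides a nonzero product of degree \<open>h\<close> with a factor in
  \<open>P g\<close>. It lies in \<open>I\<close>, and \<open>P h\<close> is
  one-dimensional.\<close>

lemma ideal_step:
  assumes I: "ideal I" and g: "P g \<subseteq> I" and gh: "step g h"
  shows "P h \<subseteq> I"
proof -
  obtain a k where S: "g \<in> S" "h \<in> S" and a: "a \<in> S \<union> {0, g0, - g0}" and k: "k \<in> {0, g0, - g0}"
    and h: "h = g + a + k"
    using gh unfolding step_def shifts_def by blast
  have mult: "(k = 0 \<longrightarrow> span_prod mu (P g) (P a) \<noteq> {0}) \<and>
        (k = g0 \<longrightarrow> span_prod br (P g) (P a) \<noteq> {0}) \<and>
        (k = - g0 \<longrightarrow> span_prod mu (span_prod mu (P g) (P a)) (P (- g0)) \<noteq> {0})"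
    using multiplicative S a k h unfolding support_multiplicative_def by blast
  have "\<exists>x\<in>I \<inter> P h. x \<noteq> 0"
    using k
  proof (elim insertE emptyE)
    assume "k = 0"
    then obtain x y where xy: "x \<in> P g" "y \<in> P a" "mu x y \<noteq> 0"
      using mult span_prod_nonzeroE by metis
    then show ?thesis
      using mu_degree[OF xy(1,2)] ideal_closed(3)[OF I _ P_in_V[OF xy(2)], of x] g h \<open>k = 0\<close>
      by (intro bexI[of _ "mu x y"]) auto
  next
    assume "k = g0"
    then obtain x y where xy: "x \<in> P g" "y \<in> P a" "br x y \<noteq> 0"
      using mult span_prod_nonzeroE by metis
    then show ?thesis
      using br_degree[OF xy(1,2)] ideal_closed(1)[OF I _ P_in_V[OF xy(2)], of x] g h \<open>k = g0\<close>
      by (intro bexI[of _ "br x y"]) auto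
  next
    assume "k = - g0"
    then obtain x y where xy: "x \<in> span_prod mu (P g) (P a)" "y \<in> P (- g0)" "mu x y \<noteq> 0"
      using mult span_prod_nonzeroE by metis
    \<comment> \<open>For the shift \<open>- g0\<close> the witness is a double product. The inner
      one is an element of a span, so its degree and its membership in \<open>I\<close> are obtained
      for the whole span.\<close>
    have "span_prod mu (P g) (P a) \<subseteq> I \<inter> P (g + a)"
      using ideal_closed(3)[OF I] g P_in_V mu_degree
      by (subst span_prod_subset_iff[OF subspace_inter[OF ideal_subspace[OF I] subspace_P]]) blast
    then have "x \<in> I" "x \<in> P (g + a)"
      using xy by auto
    then show ?thesis
      using xy mu_degree[OF _ xy(2), of x "g + a"] ideal_closed(3)[OF I _ P_in_V[OF xy(2)], of x]
        h \<open>k = - g0\<close>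
      by (intro bexI[of _ "mu x y"]) auto
  qed
  then show ?thesis
    using P_subset_ideal[OF I S(2)] by blast
qed

lemma ideal_reach:
  assumes I: "ideal I" and g: "P g \<subseteq> I" and "reach g h"
  shows "P h \<subseteq> I"
  using assms(3) by (induction rule: rtranclp_induct) (auto simp: g dest: ideal_step[OF I])

text \<open>
  Reachability only gives \<open>P c\<close> or \<open>P (- c)\<close>. By tightness at 0, the part of \<open>P 0\<close> acting on
  \<open>P c\<close> is spanned by products having a factor in \<open>I\<close>, and \<open>P c\<close> times \<open>P 0\<close> is nonzero.
\<close>

lemma ideal_component:
  assumes I: "ideal I" and gS: "g \<in> S" and g: "P g \<subseteq> I" and c: "c \<in> component g"
  shows "P c \<subseteq> I"
proof -
  have cS: "c \<in> S" and gc: "connected g c"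
    using c by (auto simp: component_def)
  have either: "P h \<subseteq> I \<or> P (- h) \<subseteq> I" if "connected g h" for h
    using that ideal_reach[OF I g] by (auto simp: connected_def)
  \<comment> \<open>The relation \<open>p = - h + k\<close> is a step from \<open>- h\<close> to
    \<open>p\<close>. If \<open>h\<close> is in the class of \<open>g\<close>, then either
    \<open>P h\<close>, or \<open>P (- h)\<close> and with it \<open>P p\<close>, lies in
    \<open>I\<close>. If not, \<open>h\<close> and \<open>p\<close> are both unconnected to
    \<open>c\<close>.\<close>
  have key: "br x y \<in> I \<and> mu x y \<in> I \<or> (\<forall>z\<in>P c. orth z (br x y) \<and> orth z (mu x y))"
    if hp: "h \<in> S" "p \<in> S" "p = - h + k" "k \<in> shifts" and xy: "x \<in> P h" "y \<in> P p" for h p k x y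
  proof -
    have st: "step (- h) p"
      using hp by (intro stepI[of "- h" p 0 k]) auto
    show ?thesis
    proof (cases "connected g h")
      case True
      then have "x \<in> I \<or> y \<in> I"
        using either[OF True] ideal_step[OF I _ st] xy by blast
      then have "br x y \<in> I \<and> mu x y \<in> I"
        using ideal_closed(1,3)[OF I _ P_in_V[OF xy(2)], of x]
          ideal_closed(2,4)[OF I _ P_in_V[OF xy(1)], of y] by blast
      then show ?thesis ..
    next
      case False
      have hp_conn: "connected h p"
        using step_connected[OF st] connected_trans connected_refl(2) by blast
      have nc: "\<not> connected c h" "\<not> connected c p"
        using False gc hp_conn connected_trans connected_sym by blast+
      have "orth z (br x y) \<and> orth z (mu x y)" if z: "z \<in> P c" for z
      proof -
        have "orth z x" "orth z y"
          using orth_unconnected[OF cS hp(1) nc(1) z xy(1)]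
            orth_unconnected[OF cS hp(2) nc(2) z xy(2)] by auto
        then show ?thesis
          using orth_products[of z x y] z xy unfolding homogeneous_def by blast
      qed
      then show ?thesis by blast
    qed
  qed
  let ?W = "{y \<in> V. \<forall>z\<in>P c. mu z y \<in> I}"
  have zero: "0 \<in> I"
    by (rule subspace_0[OF ideal_subspace[OF I]])
  have W: "subspace ?W"
    using subspace_V ideal_subspace[OF I] P_in_V zero
    by (intro subspaceI)
      (auto simp: subspace_0 subspace_add subspace_scale bilinear_on_zero[OF mu_bilinear]
        bilinear_on_add[OF mu_bilinear] bilinear_on_scale[OF mu_bilinear])
  have in_W: "br x y \<in> ?W" "mu x y \<in> ?W"
    if hp: "h \<in> S" "p \<in> S" "p = - h + k" "k \<in> shifts" and xy: "x \<in> P h" "y \<in> P p" for h p k x y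
  proof -
    have V: "br x y \<in> V" "mu x y \<in> V"
      using br_in_V mu_in_V P_in_V xy by auto
    then have "mu z (br x y) \<in> I \<and> mu z (mu x y) \<in> I" if z: "z \<in> P c" for z
      using key[OF hp xy] z ideal_closed(4)[OF I _ P_in_V[OF z]] zero by (auto simp: orth_def)
    then show "br x y \<in> ?W" "mu x y \<in> ?W"
      using V by auto
  qed
  have "P 0 \<subseteq> ?W"
  proof (rule tight_subset[OF _ W])
    show "tight 0"
      by (rule tight) simp
    fix h p x y
    assume hp: "h \<in> S" "p \<in> S" and xy: "x \<in> P h" "y \<in> P p"
    show "br x y \<in> ?W" if "p = - h - g0 + 0"
      using in_W(1)[OF hp, of "- g0"] xy that by simp
    show "mu x y \<in> ?W" if "p = - h + 0"
      using in_W(2)[OF hp, of 0] xy that by simp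
  qed
  moreover obtain x y where xy: "x \<in> P c" "y \<in> P 0" "mu x y \<noteq> 0"
  proof -
    have "span_prod mu (P c) (P 0) \<noteq> {0}"
      using multiplicative cS unfolding support_multiplicative_def by force
    then show thesis
      using that span_prod_nonzeroE by metis
  qed
  ultimately have "mu x y \<in> I"
    by blast
  moreover have "mu x y \<in> P c"
    using mu_degree[OF xy(1,2)] by simp
  ultimately show ?thesis
    using P_subset_ideal[OF I cS] xy(3) by blast
qed

section \<open>Blocks as minimal and simple ideals\<close>

lemma block_subset_ideal:
  assumes I: "ideal I" and gS: "g \<in> S" and g: "P g \<subseteq> I"
  shows "block (component g) \<subseteq> I"
proof -
  have "hom_part (component g) \<subseteq> I"
    using ideal_component[OF I gS g] by (auto simp: hom_part_def)
  moreover have "br x y \<in> I" "mu x y \<in> I" if "x \<in> I" "y \<in> I" for x y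
    using ideal_closed(1,3)[OF I that(1), of y] that(2) ideal_subset_V[OF I] by blast+
  ultimately have "gens (component g) \<subseteq> I"
    unfolding gens_def by blast
  then show ?thesis
    unfolding block_def by (rule span_minimal[OF _ ideal_subspace[OF I]])
qed

text \<open>A nonzero ideal contains some \<open>P g\<close> with \<open>g\<close> in
  \<open>S\<close>. Inside the block of \<open>C\<close> this forces \<open>g\<close> into
  \<open>C\<close> by \<open>block_support\<close>, and then the whole block is contained.\<close>

lemma subideal_of_block:
  assumes C: "C \<in> classes" and I: "ideal I" "I \<noteq> {0}" "I \<subseteq> block C"
  shows "I = block C"
proof -
  obtain g where g: "g \<in> S" "P g \<subseteq> I"
    using ideal_contains_component[OF I(1,2)] by blast
  then have "block C \<inter> P g = P g"
    using I by blast
  then have "g \<in> restricted_support g0 (\<lambda>g. block C \<inter> P g)"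
    using g(1) by (simp add: restricted_support_def)
  then have "g \<in> C"
    by (simp only: block_support[OF C])
  then have "C = component g"
    using class_component[OF C] by blast
  then show ?thesis
    using block_subset_ideal[OF I(1) g] I(3) by blast
qed

lemma minimal_ideal_iff: "minimal_ideal I \<longleftrightarrow> I \<in> block ` classes"
proof
  assume min: "minimal_ideal I"
  then have I: "ideal I" "I \<noteq> {0}"
    by (auto simp: minimal_ideal_def)
  obtain g where g: "g \<in> S" "P g \<subseteq> I"
    using ideal_contains_component[OF I] by blast
  then have "block (component g) = I"
    using min block_subset_ideal[OF I(1) g] block_ideal[OF component_classes[OF g(1)]]
      block_nonzero[OF component_classes[OF g(1)]]
    by (simp add: minimal_ideal_def)
  then show "I \<in> block ` classes"
    using component_classes[OF g(1)] by blast
next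
  assume "I \<in> block ` classes"
  then obtain C where C: "C \<in> classes" "I = block C"
    by blast
  show "minimal_ideal I"
    unfolding minimal_ideal_def C(2)
    using block_ideal[OF C(1)] block_nonzero[OF C(1)] subideal_of_block[OF C(1)] by simp
qed

text \<open>Because the rest of \<open>V\<close> is orthogonal to the block, an ideal of the block
  is already an ideal of \<open>V\<close>, and \<open>subideal_of_block\<close> applies.\<close>

lemma block_simple:
  assumes C: "C \<in> classes"
  shows "poisson_color_algebra.simple_algebra scale (block C) (\<lambda>g. block C \<inter> P g) br mu"
proof -
  let ?J = "block C"
  interpret J: poisson_color_algebra scale eps g0 ?J "\<lambda>g. ?J \<inter> P g" br mu
    by (rule ideal_poisson_color_algebra[OF block_ideal[OF C]])
  have JV: "?J \<subseteq> V"
    by (rule ideal_subset_V[OF block_ideal[OF C]])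
  \<comment> \<open>On the block, \<open>v\<close> acts like its block part. This turns a nonzero
    product with a factor in \<open>P 0\<close> or \<open>P (- g0)\<close>, which may lie outside
    the block, into one within the block.\<close>
  have reduce: "\<exists>a\<in>?J. \<forall>x\<in>?J. br x v = br x a \<and> br v x = br a x \<and> mu x v = mu x a \<and> mu v x = mu a x"
    if v: "v \<in> V" for v
  proof -
    obtain a b where ab: "v = a + b" "a \<in> ?J" "b \<in> V" "\<And>x. x \<in> ?J \<Longrightarrow> orth b x"
      using block_decomp[OF C v] by metis
    have "br x v = br x a \<and> br v x = br a x \<and> mu x v = mu x a \<and> mu v x = mu a x" if x: "x \<in> ?J" for x
    proof -
      have "x \<in> V" "a \<in> V"
        using x ab JV by auto
      then show ?thesis
        using ab(3) ab(4)[OF x] unfolding ab(1)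
        by (simp add: orth_def bilinear_on_add[OF br_bilinear] bilinear_on_add[OF mu_bilinear])
    qed
    then show ?thesis
      using ab(2) by blast
  qed
  obtain g where g: "g \<in> S" "g \<in> C"
    using C component_mem by (auto simp: classes_def)
  have PJ: "P g \<subseteq> ?J"
    by (rule P_subset_block[OF g(2)])
  \<comment> \<open>Multiplicativity is applied to \<open>g + 0 + 0 = g\<close> and
    \<open>g + (- g0) + g0 = g\<close>, so that the resulting degree is in \<open>S\<close>
    automatically.\<close>
  have nz: "span_prod mu (P g) (P 0) \<noteq> {0}" "span_prod br (P g) (P (- g0)) \<noteq> {0}"
    using multiplicative g(1) unfolding support_multiplicative_def by force+
  obtain x y where "x \<in> P g" "y \<in> P 0" "mu x y \<noteq> 0"
    using nz(1) span_prod_nonzeroE by metis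
  moreover from this obtain a where "a \<in> ?J" "mu x y = mu x a"
    using reduce[OF P_in_V, of y 0] PJ by blast
  ultimately have mu_nz: "span_prod mu ?J ?J \<noteq> {0}"
    using PJ by (intro span_prod_nonzeroI[of x _ a]) auto
  obtain x y where "x \<in> P g" "y \<in> P (- g0)" "br x y \<noteq> 0"
    using nz(2) span_prod_nonzeroE by metis
  moreover from this obtain b where "b \<in> ?J" "br x y = br x b"
    using reduce[OF P_in_V, of y "- g0"] PJ by blast
  ultimately have "span_prod br ?J ?J \<noteq> {0}"
    using PJ by (intro span_prod_nonzeroI[of x _ b]) auto
  moreover have "K = {0} \<or> K = ?J" if K: "J.ideal K" for K
  proof -
    have KJ: "K \<subseteq> ?J"
      by (rule J.ideal_subset_V[OF K])
    have "K \<inter> (?J \<inter> P h) = K \<inter> P h" for h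
      using KJ by blast
    then have "graded_subspace K"
      using K KJ JV unfolding J.ideal_iff J.graded_subspace_def graded_subspace_def
      by (simp only:) blast
    moreover have "br x v \<in> K \<and> br v x \<in> K \<and> mu x v \<in> K \<and> mu v x \<in> K"
      if "x \<in> K" "v \<in> V" for x v
      using reduce[OF that(2)] that(1) KJ K unfolding J.ideal_iff by (metis subsetD)
    ultimately have "ideal K"
      by (simp add: ideal_iff)
    then show ?thesis
      using subideal_of_block[OF C _ _ KJ] by blast
  qed
  ultimately show ?thesis
    using mu_nz unfolding J.simple_algebra_def by blast
qed

lemma direct_sum_minimal_ideals: "direct_sum {I. minimal_ideal I} (\<lambda>I. I) V"
  unfolding direct_sum_def
proof (intro conjI allI impI ballI)
  show "subspace I" if "I \<in> {I. minimal_ideal I}" for I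
    using that ideal_subspace by (simp add: minimal_ideal_def)
next
  have blocks: "{I. minimal_ideal I} = block ` classes"
    using minimal_ideal_iff by blast
  have "V \<subseteq> span (\<Union>C\<in>classes. block C)"
    by (subst V_span_gens) (intro span_mono UN_mono gens_subset_block order_refl)
  moreover have "span (\<Union>C\<in>classes. block C) \<subseteq> V"
    using ideal_subset_V[OF block_ideal] by (intro span_minimal subspace_V) blast
  ultimately show "V = span (\<Union>I\<in>{I. minimal_ideal I}. I)"
    unfolding blocks by simp
next
  fix F x I
  assume F: "finite F" "F \<subseteq> {I. minimal_ideal I}" and x: "\<forall>I\<in>F. x I \<in> I"
    and sum: "sum x F = 0" and I: "I \<in> F"
  have block: "\<exists>C\<in>classes. K = block C" if "K \<in> F" for K
    using F that minimal_ideal_iff by blast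
  have FV: "x K \<in> V" if "K \<in> F" for K
    using that F x ideal_subset_V unfolding minimal_ideal_def by blast
  have orth_other: "orth (x K) y" if K: "K \<in> F" and D: "D \<in> classes" "K \<noteq> block D" "y \<in> block D" for K D y
    using block[OF K] x K D block_orth by metis
  obtain C where C: "C \<in> classes" "I = block C"
    using block[OF I] by blast
  \<comment> \<open>The relation makes \<open>x I\<close> minus the sum of the other terms, each
    orthogonal to the block \<open>I\<close>. Being in \<open>I\<close>, it is also orthogonal to
    all other blocks, hence central.\<close>
  have own: "orth (x I) y" if y: "y \<in> block C" for y
  proof -
    have yV: "y \<in> V"
      using y ideal_subset_V[OF block_ideal[OF C(1)]] by blast
    have "sum x (F - {I}) \<in> {z \<in> V. orth y z}"
      using orth_other[OF _ C(1) _ y] FV C(2)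
      by (intro subspace_sum[OF subspace_orth[OF yV]]) (auto intro: orth_sym)
    moreover have "x I = - sum x (F - {I})"
      using sum sum.remove[OF F(1) I, of x] by (simp add: eq_neg_iff_add_eq_0)
    ultimately have "x I \<in> {z \<in> V. orth y z}"
      using subspace_neg[OF subspace_orth[OF yV]] by metis
    then show ?thesis
      by (simp add: orth_sym)
  qed
  show "x I = 0"
  proof (rule orth_center[OF FV[OF I]])
    have "orth (x I) y" if "D \<in> classes" "y \<in> gens D" for D y
      using that gens_subset_block[of D] own orth_other[OF I that(1)] C(2) by (metis subsetD)
    then have "span (\<Union>D\<in>classes. gens D) \<subseteq> {z \<in> V. orth (x I) z}"
      using gens_subset_V by (intro span_minimal subspace_orth FV[OF I]) blast
    then show "orth (x I) y" if "y \<in> V" for y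
      using that V_span_gens by blast
  qed
qed

end

theorem theorem4:
  fixes scale :: "'k::field \<Rightarrow> 'v::ab_group_add \<Rightarrow> 'v"
    and eps :: "'g::ab_group_add \<Rightarrow> 'g \<Rightarrow> 'k"
    and g0 :: 'g
    and V :: "'v set"
    and P :: "'g \<Rightarrow> 'v set"
    and br mu :: "'v \<Rightarrow> 'v \<Rightarrow> 'v"
  assumes "\<And>x::'g. x + x = 0 \<Longrightarrow> x = 0"
    and "poisson_color_algebra scale eps g0 V P br mu"
    and "symmetric_set (restricted_support g0 P)"
    and "poisson_color_algebra.centerless V br mu"
    and "poisson_color_algebra.support_multiplicative scale g0 P br mu"
    and "poisson_color_algebra.maximal_length scale g0 P"
    and "\<And>\<beta>. \<beta> \<in> {0, g0, - g0, g0 + g0, - (g0 + g0), - (g0 + g0 + g0)} \<Longrightarrow>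
           poisson_color_algebra.tight scale g0 P br mu \<beta>"
  shows "vector_space.direct_sum scale
           {I. poisson_color_algebra.minimal_ideal scale V P br mu I} (\<lambda>I. I) V \<and>
         (\<forall>I. poisson_color_algebra.minimal_ideal scale V P br mu I \<longrightarrow>
            poisson_color_algebra scale eps g0 I (\<lambda>g. I \<inter> P g) br mu \<and>
            poisson_color_algebra.simple_algebra scale I (\<lambda>g. I \<inter> P g) br mu \<and>
            (\<forall>g \<in> restricted_support g0 (\<lambda>g. I \<inter> P g).
             \<forall>h \<in> restricted_support g0 (\<lambda>g. I \<inter> P g).
               support_connected g0 (restricted_support g0 (\<lambda>g. I \<inter> P g)) g h))"
proof -
  interpret tight_poisson_color_algebra scale eps g0 V P br mu
    using assms(2-7)
    by (simp add: tight_poisson_color_algebra_def tight_poisson_color_algebra_axioms_def)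
  show ?thesis
  proof (intro conjI allI impI)
    show "direct_sum {I. minimal_ideal I} (\<lambda>I. I) V"
      by (rule direct_sum_minimal_ideals)
  next
    fix I
    assume "minimal_ideal I"
    then obtain g where g: "g \<in> S" "I = block (component g)"
      by (auto simp: minimal_ideal_iff classes_def)
    then have C: "component g \<in> classes"
      by (simp add: component_classes)
    show "poisson_color_algebra scale eps g0 I (\<lambda>g. I \<inter> P g) br mu"
      "poisson_color_algebra.simple_algebra scale I (\<lambda>g. I \<inter> P g) br mu"
      unfolding g(2) by (rule ideal_poisson_color_algebra block_ideal block_simple C)+
    show "\<forall>g \<in> restricted_support g0 (\<lambda>g. I \<inter> P g).
             \<forall>h \<in> restricted_support g0 (\<lambda>g. I \<inter> P g).
               support_connected g0 (restricted_support g0 (\<lambda>g. I \<inter> P g)) g h"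
      unfolding g(2) block_support[OF C]
      using component_support_connected[OF _ _ g(1)] by blast
  qed
qed

end
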